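(* Let $n\ge 3$ be an integer and let $a,b,c\in\mathbb{R}$ with $c\neq b$. The circulant matrix $\mathrm{Circ}(a,b,c,\ldots,c,b)\in\mathcal{M}_n(\mathbb{R})$ (first row: $a$, then $b$, then $n-3$ entries equal to $c$, then $b$) is invertible if and only if $$\big(a+2b+(n-3)c\big)\prod_{j=1}^{\lceil\frac{n-1}{2}\rceil}\Big[a-c+2(b-c)\cos\Big(\frac{2\pi j}{n}\Big)\Big]\neq 0,$$ and in this case $\mathrm{Circ}(a,b,c,\ldots,c,b)^{-1}=\mathrm{Circ}(g_1,\ldots,g_n)$, where $g_j=g_j(a,b,c)$ is given as follows. If $a\neq 3c-2b$, then $$g_j(a,b,c)=\frac{U_{j-2}(q)+U_{n-j}(q)}{2(c-b)[T_n(q)-1]}-\frac{c}{(a+2b-3c)\big(a+2b+(n-3)c\big)},\qquad j=1,\ldots,n,$$ with $q=\dfrac{c-a}{2(b-c)}$; and if $a=3c-2b$, then $$g_j(3c-2b,b,c)=\frac{1}{12n(c-b)}\big(n^2-1-6(j-1)(n+1-j)\big)+\frac{1}{n^2c},\qquad j=1,\ldots,n.$$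
   Context: For $(a_1,\ldots,a_n)\in\mathbb{R}^n$, $\mathrm{Circ}(a_1,\ldots,a_n)\in\mathcal{M}_n(\mathbb{R})$ denotes the circulant matrix whose $(i,j)$ entry is $a_{1+((j-i)\bmod n)}$; its first row is $(a_1,\ldots,a_n)$ and each row is the cyclic right shift of the previous one. $\{T_m\}_{m\in\mathbb{Z}}$ and $\{U_m\}_{m\in\mathbb{Z}}$ are the Chebyshev polynomials of the first and second kind: both satisfy $Q_{m+1}(x)=2xQ_m(x)-Q_{m-1}(x)$ for all $m\in\mathbb{Z}$, with $T_0(x)=U_0(x)=1$, $T_1(x)=x$, $U_1(x)=2x$. In particular $U_{-1}(x)=0$. *)

theory Defs
  imports "Jordan_Normal_Form.Matrix" "HOL-Computational_Algebra.Polynomial"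
begin

text \<open>The rows and columns of a matrix are numbered from 0 here, so the entry with index
  \<open>1 + ((j - i) mod n)\<close> of the first row becomes \<open>xs ! ((j - i) mod n)\<close>. The difference is
  taken in the integers, as subtraction of naturals would truncate.\<close>

definition circ :: "'a list \<Rightarrow> 'a mat" where
  "circ xs = (let n = length xs in
     mat n n (\<lambda>(i, j). xs ! nat ((int j - int i) mod int n)))"

text \<open>The unique sequence of polynomials \<open>Q m\<close>, indexed by all integers \<open>m\<close>, with
  \<open>Q 0 = 1\<close>, \<open>Q 1 = p\<close> and \<open>Q (m + 1) = 2 x Q m - Q (m - 1)\<close>. For negative \<open>m\<close> the
  recurrence is run backwards.\<close>

function cheb_seq :: "real poly \<Rightarrow> int \<Rightarrow> real poly" where
  "cheb_seq p m =
     (if m = 0 then 1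
      else if m = 1 then p
      else if m > 1 then [:0, 2:] * cheb_seq p (m - 1) - cheb_seq p (m - 2)
      else [:0, 2:] * cheb_seq p (m + 1) - cheb_seq p (m + 2))"
  by pat_completeness auto
termination
  by (relation "measure (\<lambda>(p, m). nat \<bar>2 * m - 1\<bar>)") auto

declare cheb_seq.simps [simp del]

definition cheb_T :: "int \<Rightarrow> real poly" where
  "cheb_T = cheb_seq [:0, 1:]"

definition cheb_U :: "int \<Rightarrow> real poly" where
  "cheb_U = cheb_seq [:0, 2:]"

lemma cheb_seq_0: "cheb_seq p 0 = 1"
  by (simp add: cheb_seq.simps)

lemma cheb_seq_1: "cheb_seq p 1 = p"
  by (simp add: cheb_seq.simps)

lemma cheb_seq_rec: "cheb_seq p (m + 1) = [:0, 2:] * cheb_seq p m - cheb_seq p (m - 1)"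
proof (cases "m \<ge> 1")
  case True
  then show ?thesis
    by (subst cheb_seq.simps) simp
next
  case False
  then have "cheb_seq p (m - 1) = [:0, 2:] * cheb_seq p m - cheb_seq p (m + 1)"
    by (subst cheb_seq.simps) (simp add: add.commute)
  then show ?thesis
    by simp
qed

lemma cheb_T_0: "cheb_T 0 = 1"
  and cheb_T_1: "cheb_T 1 = [:0, 1:]"
  and cheb_T_rec: "cheb_T (m + 1) = [:0, 2:] * cheb_T m - cheb_T (m - 1)"
  unfolding cheb_T_def by (rule cheb_seq_0 cheb_seq_1 cheb_seq_rec)+

lemma cheb_U_0: "cheb_U 0 = 1"
  and cheb_U_1: "cheb_U 1 = [:0, 2:]"
  and cheb_U_rec: "cheb_U (m + 1) = [:0, 2:] * cheb_U m - cheb_U (m - 1)"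
  unfolding cheb_U_def by (rule cheb_seq_0 cheb_seq_1 cheb_seq_rec)+

lemma cheb_U_minus_1: "cheb_U (- 1) = 0"
  using cheb_U_rec[of 0] by (simp add: cheb_U_0 cheb_U_1)

text \<open>\<open>B\<close> is the inverse of \<open>A\<close>; it is unique when it exists.\<close>

definition is_inverse_mat :: "'a :: semiring_1 mat \<Rightarrow> 'a mat \<Rightarrow> bool" where
  "is_inverse_mat A B \<longleftrightarrow> square_mat A \<and> inverts_mat A B \<and> inverts_mat B A"

end

theory Submission
  imports Defs "Jordan_Normal_Form.Determinant"
begin

text \<open>
  Let \<open>P\<close> be the cyclic shift, \<open>J\<close> the all-ones matrix and \<open>d = b - c\<close>. The matrix of the theorem is
  \<open>A = d (P + P\<inverse> - 2 q I) + c J\<close>, since \<open>a - c = - 2 q d\<close>. On \<open>n\<close>-periodic sequences it is thus the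
  difference operator of the Chebyshev recurrence plus a multiple of the total sum
  (\<open>circ3_row_action\<close>), and it is enough to study sequences.

  A circulant matrix with first row \<open>G\<close> inverts \<open>A\<close> as soon as \<open>A\<close> sends the periodic extension of \<open>G\<close>
  to the unit impulse at 0 (\<open>is_inverse_circ3\<close>). Such a \<open>G\<close> is a Green function: away from 0 it
  solves a homogeneous recurrence, and at 0 the recurrence jumps. For \<open>q \<noteq> 1\<close> the sequence
  \<open>U (m - 1) + U (n - 1 - m)\<close> solves the recurrence, takes the same value at 0 and \<open>n\<close>, and has the
  jump \<open>2 - 2 T n\<close> at 0, because \<open>T n = q U (n - 1) - U (n - 2)\<close>. After normalisation a constant is
  subtracted to cancel the contribution of \<open>c J\<close>; its value follows from the sum of the sequence,
  which the recurrence itself determines (\<open>sum_cyclic_recurrence\<close>). For \<open>q = 1\<close> the operator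
  \<open>P + P\<inverse> - 2 I\<close> is the second difference and kills constants, so it can only produce the impulse
  minus its mean \<open>1 / n\<close>. A quadratic polynomial in \<open>m\<close> does this, and the term \<open>c J\<close> acting on a constant
  restores the mean.

  The formula divides by \<open>T n - 1\<close> and by the row sum of \<open>A\<close>. Writing \<open>2 q = z + 1 / z\<close> with complex \<open>z\<close>
  gives \<open>2 T n = z ^ n + 1 / z ^ n\<close>, so \<open>T n = 1\<close> exactly when \<open>z\<close> is an \<open>n\<close>-th root of unity, that is
  when \<open>q = cos (2 \<pi> j / n)\<close> for some \<open>j\<close> (\<open>cheb_T_eq_1_imp\<close>). Hence a nonzero product makes the
  formula meaningful and \<open>A\<close> invertible. If the product vanishes, either the constant sequence or
  \<open>k \<mapsto> cos (2 \<pi> j k / n)\<close> lies in the kernel of \<open>A\<close> (\<open>not_invertible_row_sum\<close>,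
  \<open>not_invertible_cos\<close>).
\<close>

section \<open>The action of the matrix on periodic sequences\<close>

lemma sum_periodic_shift:
  fixes f :: "int \<Rightarrow> real"
  assumes "\<And>x. f (x + int n) = f x"
  shows "(\<Sum>k<n. f (int k + int i)) = (\<Sum>k<n. f (int k))"
proof (induction i)
  case (Suc i)
  let ?h = "\<lambda>k. f (int k + int i)"
  have "?h 0 + (\<Sum>k<n. ?h (Suc k)) = (\<Sum>k<n. ?h k) + ?h n"
    using sum.lessThan_Suc_shift[of ?h n] by simp
  moreover have "?h n = ?h 0"
    using assms[of "int i"] by (simp add: add.commute)
  ultimately show ?case
    using Suc by (simp add: algebra_simps)
qed simp

lemma sum_periodic_reflect:
  fixes f :: "int \<Rightarrow> real"
  assumes "\<And>x. f (x + int n) = f x"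
  shows "(\<Sum>k<n. f (int j - int k)) = (\<Sum>k<n. f (int k))"
proof -
  have "(\<Sum>k<n. f (int j - int k)) = (\<Sum>k<n. f (int j - int (n - Suc k)))"
    by (rule sum.nat_diff_reindex[symmetric])
  also have "\<dots> = (\<Sum>k<n. f (int k + int (Suc j)))"
  proof (rule sum.cong[OF refl])
    fix k assume "k \<in> {..<n}"
    then have "int j - int (n - Suc k) + int n = int k + int (Suc j)"
      by auto
    then show "f (int j - int (n - Suc k)) = f (int k + int (Suc j))"
      by (metis assms)
  qed
  also have "\<dots> = (\<Sum>k<n. f (int k))"
    by (rule sum_periodic_shift[of f, OF assms])
  finally show ?thesis .
qed

abbreviation (input) circ3 :: "nat \<Rightarrow> real \<Rightarrow> real \<Rightarrow> real \<Rightarrow> real mat" where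
  "circ3 n a b c \<equiv> circ (a # b # replicate (n - 3) c @ [b])"

lemma nth_first_row:
  assumes "n \<ge> 3" and "k < n"
  shows "(a # b # replicate (n - 3) c @ [b]) ! k
    = c + (if k = 0 then a - c else 0) + (if k = 1 then b - c else 0)
        + (if k = n - 1 then b - c else (0::real))"
proof -
  consider "k = 0" | "k = 1" | "k = n - 1" "k \<ge> 2" | m where "k = Suc (Suc m)" "m < n - 3"
    using assms by (cases k; cases "k - 1") fastforce+
  then show ?thesis
    using assms by cases (auto simp: nth_append nth_Cons split: nat.splits)
qed

lemma circ_carrier: "length xs = n \<Longrightarrow> circ xs \<in> carrier_mat n n"
  by (simp add: circ_def Let_def)

lemma circ_index:
  "length xs = n \<Longrightarrow> i < n \<Longrightarrow> j < n \<Longrightarrow> circ xs $$ (i, j) = xs ! nat ((int j - int i) mod int n)"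
  by (simp add: circ_def Let_def)

lemma circ3_carrier: "n \<ge> 3 \<Longrightarrow> circ3 n a b c \<in> carrier_mat n n"
  by (rule circ_carrier) simp

text \<open>After the summation index is moved to the diagonal, the first row is \<open>c\<close> everywhere except for
  corrections at the indices \<open>0\<close>, \<open>1\<close> and \<open>n - 1\<close>, which are three distinct ones as \<open>n \<ge> 3\<close>. Sequences
  indexed by the integers spare every reduction modulo \<open>n\<close> in the formula.\<close>

lemma circ3_row_action:
  fixes v :: "int \<Rightarrow> real"
  assumes n: "n \<ge> 3" and i: "i < n" and per: "\<And>x. v (x + int n) = v x"
  shows "(\<Sum>k<n. circ3 n a b c $$ (i, k) * v (int k))
    = c * (\<Sum>k<n. v (int k)) + (a - c) * v (int i) + (b - c) * (v (int i + 1) + v (int i - 1))"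
proof -
  let ?xs = "a # b # replicate (n - 3) c @ [b]"
  let ?r = "\<lambda>x. ?xs ! nat (x mod int n)"
  let ?f = "\<lambda>x. ?r (x - int i) * v x"
  have fper: "?f (x + int n) = ?f x" for x
  proof -
    have "(x + int n - int i) mod int n = (x - int i) mod int n"
      by (metis add_diff_eq diff_add_eq mod_add_self2)
    then show ?thesis
      by (simp add: per)
  qed
  have last: "v (int (n - 1) + int i) = v (int i - 1)"
    using per[of "int i - 1"] n by (simp add: algebra_simps of_nat_diff)
  have "(\<Sum>k<n. circ3 n a b c $$ (i, k) * v (int k)) = (\<Sum>k<n. ?f (int k))"
    using n i by (intro sum.cong) (auto simp: circ_index[of _ n])
  also have "\<dots> = (\<Sum>k<n. ?f (int k + int i))"
    by (rule sum_periodic_shift[of ?f, OF fper, symmetric])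
  also have "\<dots> = (\<Sum>k<n. c * v (int k + int i)
      + (if k = 0 then (a - c) * v (int k + int i) else 0)
      + (if k = 1 then (b - c) * v (int k + int i) else 0)
      + (if k = n - 1 then (b - c) * v (int k + int i) else 0))"
  proof (rule sum.cong[OF refl])
    fix k assume "k \<in> {..<n}"
    then have k: "k < n" by simp
    then have "?f (int k + int i) = ?xs ! k * v (int k + int i)"
      by simp
    also have "\<dots> = c * v (int k + int i)
      + (if k = 0 then (a - c) * v (int k + int i) else 0)
      + (if k = 1 then (b - c) * v (int k + int i) else 0)
      + (if k = n - 1 then (b - c) * v (int k + int i) else 0)"
      unfolding nth_first_row[OF n k] by (simp add: algebra_simps)
    finally show "?f (int k + int i) = \<dots>" .
  qed
  also have "\<dots> = c * (\<Sum>k<n. v (int k + int i)) + (a - c) * v (int i)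
      + (b - c) * v (1 + int i) + (b - c) * v (int (n - 1) + int i)"
    using n by (simp add: sum.distrib sum_distrib_left)
  finally show ?thesis
    unfolding sum_periodic_shift[of v, OF per] last by (simp add: algebra_simps)
qed

section \<open>Invertibility\<close>

text \<open>The hypotheses say that \<open>A\<close> sends the periodic extension of \<open>G\<close> to the impulse at 0. Column \<open>j\<close> of the
  circulant matrix of \<open>G\<close> is that extension reflected and moved to \<open>j\<close>, and \<open>A\<close> commutes with both
  operations, so this one computation yields every column of the product. The hypothesis
  \<open>G n = G 0\<close> lets the neighbour of \<open>n - 1\<close> be written as \<open>n\<close>. Inverses of square matrices over a
  field are two-sided, so one product suffices.\<close>

lemma is_inverse_circ3:
  fixes G :: "nat \<Rightarrow> real"
  assumes n: "n \<ge> 3" and wrap: "G n = G 0"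
    and zero: "(a - c) * G 0 + (b - c) * (G 1 + G (n - 1)) + c * (\<Sum>k<n. G k) = 1"
    and pos: "\<And>m. Suc m < n \<Longrightarrow>
      (a - c) * G (Suc m) + (b - c) * (G m + G (Suc (Suc m))) + c * (\<Sum>k<n. G k) = 0"
  shows "is_inverse_mat (circ3 n a b c) (circ (map G [0..<n]))"
proof -
  let ?A = "circ3 n a b c" and ?B = "circ (map G [0..<n])"
  let ?w = "\<lambda>x. G (nat (x mod int n))"
  have A: "?A \<in> carrier_mat n n" and B: "?B \<in> carrier_mat n n"
    using n by (auto intro: circ_carrier)
  have wper: "?w (x + int n) = ?w x" for x
    by simp
  have wsum: "(\<Sum>k<n. ?w (int k)) = (\<Sum>k<n. G k)"
    by (intro sum.cong) auto
  have prod: "(?A * ?B) $$ (i, j) = (if i = j then 1 else 0)" if ij: "i < n" "j < n" for i j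
  proof -
    let ?v = "\<lambda>x. ?w (int j - x)"
    \<comment> \<open>The entry depends only on the cyclic distance from the diagonal.\<close>
    define m where "m = nat ((int j - int i) mod int n)"
    have mn: "m < n" and mi: "int m = (int j - int i) mod int n"
      using n by (auto simp: m_def nat_less_iff)
    have vper: "?v (x + int n) = ?v x" for x
      by (metis (no_types, lifting) diff_add_cancel diff_diff_eq mod_add_self2)
    have "(?A * ?B) $$ (i, j) = (\<Sum>k<n. ?A $$ (i, k) * ?v (int k))"
      using A B ij by (subst index_mult_mat)
        (auto simp: scalar_prod_def atLeast0LessThan circ_index[of "map G [0..<n]" n] nat_less_iff
          intro!: sum.cong)
    also have "\<dots> = c * (\<Sum>k<n. ?v (int k)) + (a - c) * ?v (int i)
        + (b - c) * (?v (int i + 1) + ?v (int i - 1))"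
      by (rule circ3_row_action[of _ _ ?v, OF n ij(1) vper])
    also have "(\<Sum>k<n. ?v (int k)) = (\<Sum>k<n. G k)"
      using sum_periodic_reflect[of ?w, OF wper] wsum by simp
    also have "?v (int i) = G m"
      by (simp add: m_def)
    also have "?v (int i + 1) = ?w (int m - 1)"
      by (simp add: mi mod_simps algebra_simps)
    also have "?v (int i - 1) = ?w (int m + 1)"
      by (simp add: mi mod_simps algebra_simps)
    finally have eq: "(?A * ?B) $$ (i, j) = c * (\<Sum>k<n. G k) + (a - c) * G m
        + (b - c) * (?w (int m - 1) + ?w (int m + 1))" .
    have up: "?w (int m + 1) = G (Suc m)"
    proof (cases "Suc m = n")
      case True
      then have "int m + 1 = int n" by simp
      then have "(int m + 1) mod int n = 0" by (simp only: mod_self)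
      then show ?thesis using True wrap by simp
    next
      case False
      then show ?thesis using mn by (simp add: nat_add_distrib)
    qed
    show ?thesis
    proof (cases m)
      case 0
      have "i = j"
      proof -
        have "(int j - int i) mod int n = 0"
          using mi 0 by linarith
        then have "int j mod int n = int i mod int n"
          by (simp only: mod_eq_dvd_iff mod_eq_0_iff_dvd)
        then show ?thesis using ij by simp
      qed
      moreover have "nat ((int m - 1) mod int n) = n - 1"
      proof -
        have "(- 1) mod int n = int n - 1"
          using n by (intro zmod_minus1) simp
        then show ?thesis
          unfolding 0 by simp
      qed
      ultimately show ?thesis
        unfolding eq up using zero 0 by (simp add: add.commute)
    next
      case (Suc l)
      have "i \<noteq> j"
      proof
        assume "i = j"
        then have "int m = 0" unfolding mi by simp
        then show False using Suc by simp
      qed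
      moreover have "?w (int m - 1) = G l"
        using Suc mn by simp
      ultimately show ?thesis
        unfolding eq up using pos[of l] mn Suc by (simp add: add.commute)
    qed
  qed
  have AB: "?A * ?B = 1\<^sub>m n"
    using A B prod by (intro eq_matI) auto
  have BA: "?B * ?A = 1\<^sub>m n"
    by (rule mat_mult_left_right_inverse[OF A B AB])
  show ?thesis
    using A B AB BA by (auto simp: is_inverse_mat_def inverts_mat_def)
qed

lemma invertible_imp_trivial_kernel:
  fixes A :: "real mat"
  assumes inv: "invertible_mat A" and A: "A \<in> carrier_mat n n" and v: "v \<in> carrier_vec n"
    and Av: "A *\<^sub>v v = 0\<^sub>v n"
  shows "v = 0\<^sub>v n"
proof -
  obtain B where "inverts_mat A B" "inverts_mat B A"
    using inv by (auto simp: invertible_mat_def)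
  then have AB: "A * B = 1\<^sub>m n" and BA: "B * A = 1\<^sub>m (dim_row B)"
    using A by (auto simp: inverts_mat_def)
  have "dim_col (A * B) = n" "dim_col (B * A) = dim_row B"
    unfolding AB BA by auto
  then have B: "B \<in> carrier_mat n n"
    using A by auto
  then have "v = (B * A) *\<^sub>v v"
    using BA v by simp
  also have "\<dots> = B *\<^sub>v (A *\<^sub>v v)"
    using A B v by simp
  also have "\<dots> = 0\<^sub>v n"
    using B by (auto simp: Av)
  finally show ?thesis .
qed

lemma circ3_not_invertible:
  fixes v :: "int \<Rightarrow> real"
  assumes n: "n \<ge> 3" and per: "\<And>x. v (x + int n) = v x" and nz: "v 0 \<noteq> 0"
    and ker: "\<And>x. c * (\<Sum>k<n. v (int k)) + (a - c) * v x + (b - c) * (v (x + 1) + v (x - 1)) = 0"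
  shows "\<not> invertible_mat (circ3 n a b c)"
proof
  let ?A = "circ3 n a b c" and ?x = "vec n (\<lambda>k. v (int k))"
  assume inv: "invertible_mat ?A"
  have A: "?A \<in> carrier_mat n n" by (rule circ3_carrier[OF n])
  have "?A *\<^sub>v ?x = 0\<^sub>v n"
  proof (rule eq_vecI)
    fix i assume "i < dim_vec (0\<^sub>v n :: real vec)"
    then have i: "i < n" by simp
    have "(?A *\<^sub>v ?x) $ i = (\<Sum>k<n. ?A $$ (i, k) * v (int k))"
      using A i by (auto simp: scalar_prod_def atLeast0LessThan intro!: sum.cong)
    then show "(?A *\<^sub>v ?x) $ i = 0\<^sub>v n $ i"
      using circ3_row_action[of n i v, OF n i per] ker[of "int i"] i by simp
  qed (use A in auto)
  with inv A have "?x = 0\<^sub>v n"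
    by (rule invertible_imp_trivial_kernel[OF _ _ vec_carrier])
  then have "?x $ 0 = 0" using n by simp
  then show False using n nz by simp
qed

section \<open>Chebyshev polynomials\<close>

lemma poly_cheb_U_rec: "poly (cheb_U (m + 1)) x = 2 * x * poly (cheb_U m) x - poly (cheb_U (m - 1)) x"
  by (simp add: cheb_U_rec)

lemma poly_cheb_T_rec: "poly (cheb_T (m + 1)) x = 2 * x * poly (cheb_T m) x - poly (cheb_T (m - 1)) x"
  by (simp add: cheb_T_rec)

lemma cheb_T_eq_cheb_U:
  "poly (cheb_T (int m)) x = x * poly (cheb_U (int m - 1)) x - poly (cheb_U (int m - 2)) x"
proof (induction m rule: induct_nat_012)
  case 0
  show ?case
    using poly_cheb_U_rec[of "- 1" x] by (simp add: cheb_T_0 cheb_U_0 cheb_U_minus_1)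
next
  case 1
  show ?case by (simp add: cheb_T_1 cheb_U_0 cheb_U_minus_1)
next
  case (ge2 m)
  let ?T = "\<lambda>k. poly (cheb_T k) x" and ?U = "\<lambda>k. poly (cheb_U k) x"
  have "?T (int m + 2) = 2 * x * (x * ?U (int m) - ?U (int m - 1)) - (x * ?U (int m - 1) - ?U (int m - 2))"
    using ge2 poly_cheb_T_rec[of "int m + 1" x] by (simp add: add.commute)
  also have "\<dots> = x * (2 * x * ?U (int m) - ?U (int m - 1)) - (2 * x * ?U (int m - 1) - ?U (int m - 2))"
    by (simp add: algebra_simps)
  also have "\<dots> = x * ?U (int m + 1) - ?U (int m)"
    using poly_cheb_U_rec[of "int m" x] poly_cheb_U_rec[of "int m - 1" x] by simp
  finally show ?case by (simp add: add.commute)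
qed

text \<open>Both sides satisfy the same second-order recurrence in \<open>m\<close>. Over the complex numbers the
  substitution \<open>2 x = z + 1 / z\<close> covers \<open>\<bar>x\<bar> \<le> 1\<close> and \<open>\<bar>x\<bar> > 1\<close> at once, where a trigonometric or hyperbolic
  parametrisation would need separate cases.\<close>

lemma cheb_T_Joukowski:
  fixes z :: complex
  assumes "z \<noteq> 0" and "z + inverse z = 2 * of_real x"
  shows "2 * of_real (poly (cheb_T (int m)) x) = z ^ m + inverse z ^ m"
proof (induction m rule: induct_nat_012)
  case 0
  show ?case by (simp add: cheb_T_0)
next
  case 1
  show ?case using assms by (simp add: cheb_T_1)
next
  case (ge2 m)
  let ?t = "\<lambda>k. 2 * complex_of_real (poly (cheb_T (int k)) x)"
  have "poly (cheb_T (int (Suc (Suc m)))) x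
      = 2 * x * poly (cheb_T (int (Suc m))) x - poly (cheb_T (int m)) x"
    using poly_cheb_T_rec[of "int m + 1" x] by (simp add: add.commute)
  then have "?t (Suc (Suc m)) = 2 * of_real x * ?t (Suc m) - ?t m"
    by (simp only: of_real_diff of_real_mult of_real_numeral) (simp add: algebra_simps)
  also have "\<dots> = (z + inverse z) * (z ^ Suc m + inverse z ^ Suc m) - (z ^ m + inverse z ^ m)"
    by (simp only: ge2 assms)
  also have "\<dots> = z ^ Suc (Suc m) + inverse z ^ Suc (Suc m)"
    using assms(1) by (simp add: field_simps)
  finally show ?case .
qed

text \<open>With \<open>w = z ^ n\<close> the equation \<open>T n = 1\<close> reads \<open>w + 1 / w = 2\<close>, which forces \<open>w = 1\<close>; so \<open>z\<close> is a root of
  unity and \<open>x\<close> is its real part. The upper bound on \<open>j\<close> is \<open>\<lfloor>n / 2\<rfloor>\<close> in another form; angles beyond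
  \<open>\<pi>\<close> are reflected by \<open>k \<mapsto> n - k\<close>, which preserves the cosine.\<close>

lemma cheb_T_eq_1_imp:
  assumes n: "n > 0" and T: "poly (cheb_T (int n)) x = 1" and x: "x \<noteq> 1"
  shows "\<exists>j \<in> {1..nat \<lceil>(real n - 1) / 2\<rceil>}. x = cos (2 * pi * real j / real n)"
proof -
  \<comment> \<open>A root of \<open>z\<^sup>2 - 2 x z + 1\<close>; the other root is its inverse.\<close>
  define z where "z = of_real x + csqrt (of_real x ^ 2 - 1)"
  have "z * (2 * of_real x - z) = of_real x ^ 2 - csqrt (of_real x ^ 2 - 1) ^ 2"
    by (simp add: z_def algebra_simps power2_eq_square)
  then have z1: "z * (2 * of_real x - z) = 1" by simp
  then have z0: "z \<noteq> 0" by auto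
  have zx: "z + inverse z = 2 * of_real x"
    using inverse_unique[OF z1] by simp
  have "z ^ n + inverse z ^ n = 2"
    using cheb_T_Joukowski[OF z0 zx, of n] T by simp
  then have "(z ^ n - 1) ^ 2 = 0"
    using z0 by (simp add: field_simps power2_eq_square)
  then have "z ^ n = 1" by simp
  then obtain k where k: "k < n" and zc: "z = cis (2 * pi * real k / real n)"
    using bij_betw_imp_surj_on[OF bij_betw_roots_unity[OF n]] by auto
  have "2 * x = Re (z + inverse z)"
    unfolding zx by simp
  then have xk: "x = cos (2 * pi * real k / real n)"
    unfolding zc by (simp add: cis_inverse)
  have k0: "k > 0" using x xk by (cases k) auto
  have bound: "j \<le> nat \<lceil>(real n - 1) / 2\<rceil>" if "2 * j \<le> n" for j
  proof -
    have "of_int (int j - 1) < (real n - 1) / 2"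
      using that by simp
    then have "int j - 1 < \<lceil>(real n - 1) / 2\<rceil>"
      by (simp only: less_ceiling_iff)
    then show ?thesis by linarith
  qed
  show ?thesis
  proof (cases "2 * k \<le> n")
    case True
    then show ?thesis using xk k0 bound by auto
  next
    case False
    have "2 * pi * real (n - k) / real n = 2 * pi - 2 * pi * real k / real n"
      using k by (simp add: field_simps of_nat_diff)
    then have "x = cos (2 * pi * real (n - k) / real n)"
      using xk by (simp add: cos_diff)
    moreover have "n - k \<in> {1..nat \<lceil>(real n - 1) / 2\<rceil>}"
      using False k bound[of "n - k"] by auto
    ultimately show ?thesis by blast
  qed
qed

section \<open>The entries of the inverse\<close>

lemma sum_cyclic_shift:
  fixes G :: "nat \<Rightarrow> real"
  assumes "G n = G 0"
  shows "(\<Sum>k<n. G (Suc k)) = (\<Sum>k<n. G k)"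
  using sum.lessThan_Suc_shift[of G n] assms by simp

text \<open>Adding up the recurrence over one period turns each of the shifted sums into the sum of \<open>G\<close>, so the
  total is known without a closed form for the terms.\<close>

lemma sum_cyclic_recurrence:
  fixes G :: "nat \<Rightarrow> real"
  assumes n: "n > 0" and wrap: "G n = G 0"
    and zero: "r * G 0 + d * (G 1 + G (n - 1)) = s"
    and pos: "\<And>m. Suc m < n \<Longrightarrow> r * G (Suc m) + d * (G m + G (Suc (Suc m))) = 0"
  shows "(r + 2 * d) * (\<Sum>k<n. G k) = s"
proof -
  obtain l where l: "n = Suc l" using n by (cases n) auto
  have up: "(\<Sum>k<n. G (Suc k)) = (\<Sum>k<n. G k)"
    by (rule sum_cyclic_shift[OF wrap])
  let ?S = "\<Sum>k<n. G k"
  have "?S = G 0 + (\<Sum>k<l. G (Suc k))"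
    unfolding l by (rule sum.lessThan_Suc_shift)
  then have mid: "(\<Sum>k<l. G (Suc k)) = ?S - G 0" by simp
  have "(\<Sum>k<n. G (Suc k)) = G 1 + (\<Sum>k<l. G (Suc (Suc k)))"
    unfolding l by (subst sum.lessThan_Suc_shift) simp
  then have right: "(\<Sum>k<l. G (Suc (Suc k))) = ?S - G 1" using up by simp
  have left: "(\<Sum>k<l. G k) = ?S - G (n - 1)"
    unfolding l by simp
  have "(\<Sum>m<l. r * G (Suc m) + d * (G m + G (Suc (Suc m)))) = 0"
    by (rule sum.neutral) (use pos l in auto)
  then have "r * (\<Sum>k<l. G (Suc k)) + d * ((\<Sum>k<l. G k) + (\<Sum>k<l. G (Suc (Suc k)))) = 0"
    by (simp add: sum.distrib sum_distrib_left distrib_left)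
  then have "r * (?S - G 0) + d * ((?S - G (n - 1)) + (?S - G 1)) = 0"
    unfolding left mid right .
  then show ?thesis
    using zero by (simp add: algebra_simps)
qed

text \<open>\<open>H\<close> inverts the part \<open>d (P + P\<inverse> - 2 q I)\<close> of \<open>A\<close>, and its terms add up to \<open>1 / s\<close>, where
  \<open>s = a + 2 b - 3 c\<close> is the row sum of that part. Subtracting \<open>K\<close> changes the image under that part by
  \<open>- s K\<close>, and \<open>c J\<close> contributes \<open>c (1 / s - n K)\<close>; the value of \<open>K\<close> makes the two cancel.\<close>

lemma circ3_inverse_Chebyshev:
  fixes a b c q :: real and n :: nat
  assumes n: "n \<ge> 3" and bc: "c \<noteq> b" and q: "q = (c - a) / (2 * (b - c))"
    and reg: "a \<noteq> 3 * c - 2 * b" and rs: "a + 2 * b + (real n - 3) * c \<noteq> 0"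
    and T: "poly (cheb_T (int n)) q \<noteq> 1"
  shows "is_inverse_mat (circ3 n a b c) (circ (map (\<lambda>m.
      (poly (cheb_U (int m - 1)) q + poly (cheb_U (int n - 1 - int m)) q)
        / (2 * (c - b) * (poly (cheb_T (int n)) q - 1))
      - c / ((a + 2 * b - 3 * c) * (a + 2 * b + (real n - 3) * c))) [0..<n]))"
proof -
  define u where "u m = poly (cheb_U m) q" for m
  define t where "t = poly (cheb_T (int n)) q"
  define D where "D = 2 * (c - b) * (t - 1)"
  define H where "H m = (u (int m - 1) + u (int n - 1 - int m)) / D" for m :: nat
  define K where "K = c / ((a + 2 * b - 3 * c) * (a + 2 * b + (real n - 3) * c))"
  let ?s = "a + 2 * b - 3 * c"
  have ac: "a - c = - 2 * q * (b - c)"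
    using bc unfolding q by (simp add: divide_simps) (simp add: algebra_simps)
  have D0: "D \<noteq> 0"
    using T bc by (simp add: D_def t_def)
  have s0: "?s \<noteq> 0" using reg by simp
  have u_rec: "u (x + 1) = 2 * q * u x - u (x - 1)" for x
    by (simp add: u_def poly_cheb_U_rec)
  have u0: "u 0 = 1" "u (- 1) = 0"
    by (simp_all add: u_def cheb_U_0 cheb_U_minus_1)
  have t: "t = q * u (int n - 1) - u (int n - 2)"
    by (simp add: t_def u_def cheb_T_eq_cheb_U)
  have wrap: "H n = H 0"
    by (simp add: H_def)
  have "H 0 = u (int n - 1) / D" "H 1 = (1 + u (int n - 2)) / D"
    by (simp_all add: H_def u0)
  moreover have "H (n - 1) = (1 + u (int n - 2)) / D"
  proof -
    have idx: "int (n - 1) - 1 = int n - 2" "int n - 1 - int (n - 1) = 0" using n by auto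
    show ?thesis unfolding H_def idx u0 by (simp only: add.commute)
  qed
  ultimately have ends: "H 0 = u (int n - 1) / D" "H 1 = (1 + u (int n - 2)) / D"
      "H (n - 1) = (1 + u (int n - 2)) / D" by blast+
  have zero: "(a - c) * H 0 + (b - c) * (H 1 + H (n - 1)) = 1"
  proof -
    have "(a - c) * H 0 + (b - c) * (H 1 + H (n - 1))
      = (b - c) * (2 * u (int n - 2) + 2 - 2 * q * u (int n - 1)) / D"
      unfolding ac ends by (simp add: add_divide_distrib diff_divide_distrib algebra_simps)
    also have "(b - c) * (2 * u (int n - 2) + 2 - 2 * q * u (int n - 1)) = D"
      by (simp add: D_def t algebra_simps)
    finally show ?thesis using D0 by simp
  qed
  have pos: "(a - c) * H (Suc m) + (b - c) * (H m + H (Suc (Suc m))) = 0" for m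
  proof -
    have "(a - c) * H (Suc m) + (b - c) * (H m + H (Suc (Suc m)))
      = (b - c) * ((u (int m + 1) - 2 * q * u (int m) + u (int m - 1))
        + (u (int n - 1 - int m) - 2 * q * u (int n - 2 - int m) + u (int n - 3 - int m))) / D"
      unfolding ac by (simp add: H_def add_divide_distrib diff_divide_distrib algebra_simps)
    also have "\<dots> = 0"
      using u_rec[of "int m"] u_rec[of "int n - 2 - int m"] by (simp add: algebra_simps)
    finally show ?thesis .
  qed
  have "(a - c + 2 * (b - c)) * (\<Sum>k<n. H k) = 1"
    by (rule sum_cyclic_recurrence) (use n wrap zero pos in auto)
  then have Hs: "(\<Sum>k<n. H k) = 1 / ?s"
    using s0 by (simp add: field_simps)
  have Gs: "(\<Sum>k<n. H k - K) = 1 / ?s - real n * K"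
    by (simp add: sum_subtractf Hs)
  have bal: "c * (1 / ?s - real n * K) = ?s * K"
  proof -
    have R: "?s + real n * c = a + 2 * b + (real n - 3) * c"
      by (simp add: algebra_simps)
    have "(?s + real n * c) * K = c / ?s"
      unfolding K_def R using rs by simp
    then show ?thesis by (simp add: algebra_simps)
  qed
  have "is_inverse_mat (circ3 n a b c) (circ (map (\<lambda>m. H m - K) [0..<n]))"
    by (rule is_inverse_circ3[OF n])
      (use wrap zero pos in \<open>simp_all only: Gs bal, simp_all add: algebra_simps\<close>)
  then show ?thesis
    by (simp add: H_def D_def K_def u_def t_def)
qed

text \<open>The periodic extension of \<open>F\<close> has second difference \<open>12\<close> away from 0 and \<open>12 - 12 n\<close> at 0, and the constant
  \<open>n\<^sup>2 - 1\<close> is chosen such that \<open>F\<close> adds up to 0 over a period. The factor \<open>e\<close> scales the differences to the impulse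
  minus \<open>1 / n\<close>. The constant \<open>K\<close> has no second difference, and \<open>c J\<close> maps it to the missing \<open>1 / n\<close>.\<close>

lemma circ3_inverse_quadratic:
  fixes a b c :: real and n :: nat
  assumes n: "n \<ge> 3" and bc: "c \<noteq> b" and deg: "a = 3 * c - 2 * b" and c: "c \<noteq> 0"
  shows "is_inverse_mat (circ3 n a b c) (circ (map (\<lambda>m.
      1 / (12 * real n * (c - b)) * ((real n)\<^sup>2 - 1 - 6 * real m * (real n - real m))
      + 1 / ((real n)\<^sup>2 * c)) [0..<n]))"
proof -
  define F where "F m = (real n)\<^sup>2 - 1 - 6 * real m * (real n - real m)" for m
  define e where "e = 1 / (12 * real n * (c - b))"
  define K where "K = 1 / ((real n)\<^sup>2 * c)"
  have partial: "(\<Sum>k<l. 6 * real k * (real n - real k)) = real l * (real l - 1) * (3 * real n - 2 * real l + 1)" for l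
    by (induction l) (auto simp: algebra_simps power2_eq_square)
  have "(\<Sum>k<n. F k) = 0"
    unfolding F_def sum_subtractf mult.assoc[symmetric] partial
    by (simp add: algebra_simps power2_eq_square)
  then have Gs: "(\<Sum>k<n. e * F k + K) = real n * K"
    by (simp add: sum.distrib sum_distrib_left[symmetric])
  have cK: "c * (real n * K) = 1 / real n"
    using c n by (simp add: K_def power2_eq_square)
  have e: "(b - c) * e = - 1 / (12 * real n)"
    using bc n by (simp add: e_def divide_simps)
  have ac: "a - c = - 2 * (b - c)" using deg by simp
  have "is_inverse_mat (circ3 n a b c) (circ (map (\<lambda>m. e * F m + K) [0..<n]))"
  proof (rule is_inverse_circ3[OF n])
    show "e * F n + K = e * F 0 + K" by (simp add: F_def)
  next
    have "(a - c) * (e * F 0 + K) + (b - c) * (e * F 1 + K + (e * F (n - 1) + K))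
      = ((b - c) * e) * (F 1 + F (n - 1) - 2 * F 0)"
      unfolding ac by (simp add: algebra_simps)
    also have "F 1 + F (n - 1) - 2 * F 0 = - 12 * (real n - 1)"
      using n by (simp add: F_def of_nat_diff algebra_simps)
    finally show "(a - c) * (e * F 0 + K) + (b - c) * (e * F 1 + K + (e * F (n - 1) + K))
      + c * (\<Sum>k<n. e * F k + K) = 1"
      unfolding Gs cK e using n by (simp add: field_simps)
  next
    fix m
    have "(a - c) * (e * F (Suc m) + K) + (b - c) * (e * F m + K + (e * F (Suc (Suc m)) + K))
      = ((b - c) * e) * (F m + F (Suc (Suc m)) - 2 * F (Suc m))"
      unfolding ac by (simp add: algebra_simps)
    also have "F m + F (Suc (Suc m)) - 2 * F (Suc m) = 12"
      by (simp add: F_def algebra_simps)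
    finally show "(a - c) * (e * F (Suc m) + K)
      + (b - c) * (e * F m + K + (e * F (Suc (Suc m)) + K)) + c * (\<Sum>k<n. e * F k + K) = 0"
      unfolding Gs cK e using n by (simp add: field_simps)
  qed
  then show ?thesis
    by (simp add: e_def F_def K_def)
qed

section \<open>The singular cases\<close>

lemma not_invertible_row_sum:
  fixes a b c :: real
  assumes n: "n \<ge> 3" and rs: "a + 2 * b + (real n - 3) * c = 0"
  shows "\<not> invertible_mat (circ3 n a b c)"
proof (rule circ3_not_invertible[of n "\<lambda>_. 1"])
  have "c * (\<Sum>k<n. 1) + (a - c) * 1 + (b - c) * (1 + 1) = a + 2 * b + (real n - 3) * c"
    by (simp add: algebra_simps)
  then show "c * (\<Sum>k<n. 1) + (a - c) * 1 + (b - c) * (1 + 1) = 0"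
    unfolding rs .
qed (use n in auto)

text \<open>The sequence \<open>k \<mapsto> cos (2 \<pi> j k / n)\<close> is an eigenvector of \<open>P + P\<inverse>\<close> with eigenvalue
  \<open>2 cos (2 \<pi> j / n) \<noteq> 2\<close>. As \<open>P + P\<inverse>\<close> doubles sums over a period, this sequence adds up to 0, so \<open>c J\<close> kills it
  and the factor in \<open>ev\<close> is its eigenvalue under \<open>A\<close>.\<close>

lemma not_invertible_cos:
  fixes a b c :: real
  assumes n: "n \<ge> 3" and bc: "c \<noteq> b" and j: "0 < j" "j < n"
    and ev: "a - c + 2 * (b - c) * cos (2 * pi * real j / real n) = 0"
  shows "\<not> invertible_mat (circ3 n a b c)"
proof -
  define \<theta> where "\<theta> = 2 * pi * real j / real n"
  define v where "v x = cos (of_int x * \<theta>)" for x :: int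
  have per: "v (x + int n) = v x" for x
  proof -
    have "real n * \<theta> = 2 * real j * pi"
      using n by (simp add: \<theta>_def)
    then have "of_int (x + int n) * \<theta> = of_int x * \<theta> + 2 * real j * pi"
      by (simp only: of_int_add of_int_of_nat_eq distrib_right)
    then show ?thesis
      unfolding v_def by (simp only: cos_add sin_2npi cos_2npi)
  qed
  have rec: "v (x + 1) + v (x - 1) = 2 * cos \<theta> * v x" for x
    by (simp add: v_def algebra_simps cos_add cos_diff)
  have th: "cos \<theta> \<noteq> 1"
  proof
    assume "cos \<theta> = 1"
    then obtain k :: int where "\<theta> = of_int k * 2 * pi"
      using cos_one_2pi_int by auto
    then have "real j = of_int k * real n"
      using n by (simp add: \<theta>_def field_simps)
    then have "int j = k * int n"
      by (metis of_int_eq_iff of_int_mult of_int_of_nat_eq)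
    then have "int n dvd int j" by simp
    then show False
      using j by (simp add: nat_dvd_not_less)
  qed
  have S: "(\<Sum>k<n. v (int k)) = 0"
  proof -
    have up: "(\<Sum>k<n. v (int k + 1)) = (\<Sum>k<n. v (int k))"
      using sum_periodic_shift[of v n 1, OF per] by simp
    have per': "v (x + int n - 1) = v (x - 1)" for x
      using per[of "x - 1"] by (simp add: algebra_simps)
    have down: "(\<Sum>k<n. v (int k - 1)) = (\<Sum>k<n. v (int k))"
      using sum_periodic_shift[of "\<lambda>x. v (x - 1)" n 1, OF per'] by simp
    have "2 * cos \<theta> * (\<Sum>k<n. v (int k)) = (\<Sum>k<n. v (int k + 1) + v (int k - 1))"
      by (simp add: rec sum_distrib_left)
    also have "\<dots> = 2 * (\<Sum>k<n. v (int k))"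
      by (simp add: sum.distrib up down)
    finally show ?thesis using th by simp
  qed
  show ?thesis
  proof (rule circ3_not_invertible[of n v, OF n per])
    show "v 0 \<noteq> 0" by (simp add: v_def)
    show "c * (\<Sum>k<n. v (int k)) + (a - c) * v x + (b - c) * (v (x + 1) + v (x - 1)) = 0" for x
    proof -
      have "(a - c + 2 * (b - c) * cos \<theta>) * v x = 0"
        using ev by (simp add: \<theta>_def)
      then show ?thesis
        unfolding S rec by (simp add: algebra_simps)
    qed
  qed
qed

section \<open>The criterion and the inverse\<close>

theorem theorem3p4:
  fixes n :: nat and a b c :: real
  assumes "n \<ge> 3" and "c \<noteq> b"
  shows "let A = circ (a # b # replicate (n - 3) c @ [b]);
      q = (c - a) / (2 * (b - c));
      g = (\<lambda>j :: nat.
        if a \<noteq> 3 * c - 2 * b then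
          (poly (cheb_U (int j - 2)) q + poly (cheb_U (int n - int j)) q)
            / (2 * (c - b) * (poly (cheb_T (int n)) q - 1))
          - c / ((a + 2 * b - 3 * c) * (a + 2 * b + (real n - 3) * c))
        else
          1 / (12 * real n * (c - b)) *
            ((real n)\<^sup>2 - 1 - 6 * (real j - 1) * (real n + 1 - real j))
          + 1 / ((real n)\<^sup>2 * c))
    in (invertible_mat A \<longleftrightarrow>
         (a + 2 * b + (real n - 3) * c) *
         (\<Prod>j = 1..nat \<lceil>(real n - 1) / 2\<rceil>.
            a - c + 2 * (b - c) * cos (2 * pi * real j / real n)) \<noteq> 0)
      \<and> (invertible_mat A \<longrightarrow> is_inverse_mat A (circ (map g [1..<n + 1])))"
proof -
  define A where "A = circ3 n a b c"
  define q where "q = (c - a) / (2 * (b - c))"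
  define g where "g = (\<lambda>j :: nat.
        if a \<noteq> 3 * c - 2 * b then
          (poly (cheb_U (int j - 2)) q + poly (cheb_U (int n - int j)) q)
            / (2 * (c - b) * (poly (cheb_T (int n)) q - 1))
          - c / ((a + 2 * b - 3 * c) * (a + 2 * b + (real n - 3) * c))
        else
          1 / (12 * real n * (c - b)) *
            ((real n)\<^sup>2 - 1 - 6 * (real j - 1) * (real n + 1 - real j))
          + 1 / ((real n)\<^sup>2 * c))"
  let ?J = "{1..nat \<lceil>(real n - 1) / 2\<rceil>}"
  let ?ev = "\<lambda>j. a - c + 2 * (b - c) * cos (2 * pi * real j / real n)"
  let ?P = "(a + 2 * b + (real n - 3) * c) * (\<Prod>j \<in> ?J. ?ev j)"
  have nec: "?P \<noteq> 0" if inv: "invertible_mat A"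
  proof -
    have "a + 2 * b + (real n - 3) * c \<noteq> 0"
      using not_invertible_row_sum[OF assms(1)] inv by (auto simp: A_def)
    moreover have "?ev j \<noteq> 0" if j: "j \<in> ?J" for j
    proof -
      have "\<lceil>(real n - 1) / 2\<rceil> < int n"
        using assms(1) by (simp add: ceiling_less_iff)
      then have "0 < j" "j < n" using j assms(1) by (auto simp: nat_less_iff)
      then show ?thesis
        using not_invertible_cos[OF assms, of j a] inv by (auto simp: A_def)
    qed
    ultimately show ?thesis by simp
  qed
  \<comment> \<open>The entries of the inverse are numbered from 1, those of a periodic sequence from 0.\<close>
  have shift: "map g [1..<n + 1] = map (\<lambda>m. g (Suc m)) [0..<n]"
    by (simp add: map_Suc_upt[symmetric] del: upt_Suc)
  have suff: "is_inverse_mat A (circ (map g [1..<n + 1]))" if P: "?P \<noteq> 0"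
  proof (cases "a = 3 * c - 2 * b")
    case True
    have "a + 2 * b + (real n - 3) * c = real n * c"
      using True by (simp add: algebra_simps)
    then have "c \<noteq> 0" using P by auto
    from circ3_inverse_quadratic[OF assms True this] show ?thesis
      unfolding shift unfolding A_def g_def using True by simp
  next
    case False
    have ev: "?ev j = 2 * (b - c) * (cos (2 * pi * real j / real n) - q)" for j
      using assms(2) by (simp add: q_def field_simps)
    have "q \<noteq> 1"
      using False assms(2) by (auto simp: q_def field_simps)
    moreover have "q \<noteq> cos (2 * pi * real j / real n)" if "j \<in> ?J" for j
      using P that ev[of j] by auto
    ultimately have T: "poly (cheb_T (int n)) q \<noteq> 1"
      using cheb_T_eq_1_imp[of n q] assms(1) by auto
    have R: "a + 2 * b + (real n - 3) * c \<noteq> 0"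
      using P by simp
    have idx: "int (Suc m) - 2 = int m - 1" "int n - int (Suc m) = int n - 1 - int m" for m
      by auto
    from T R show ?thesis
      using circ3_inverse_Chebyshev[OF assms q_def False] False
      unfolding shift unfolding A_def g_def idx by simp
  qed
  have "invertible_mat A" if "is_inverse_mat A B" for B
    using that by (auto simp: is_inverse_mat_def invertible_mat_def)
  then have "(invertible_mat A \<longleftrightarrow> ?P \<noteq> 0)
      \<and> (invertible_mat A \<longrightarrow> is_inverse_mat A (circ (map g [1..<n + 1])))"
    using nec suff by blast
  then show ?thesis
    unfolding Let_def A_def g_def q_def .
qed

end
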